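(* Let $q\geq 2$ and $d\geq 1$ be integers and put $N=(d+1)(q-1)$. For every set $X$ of $N+1$ points in $(\mathbb{R}\cup\{-\infty\})^d$, the number of unordered max-plus Tverberg partitions of $X$ (into $q$ subsets) is at least $\left((q-1)!\right)^d$.
   Context: Write $\mathbb{R}_{\max}=\mathbb{R}\cup\{-\infty\}$, with $-\infty+a=-\infty$ for all $a\in\mathbb{R}_{\max}$ and $-\infty\le a$ for all $a$. For $\lambda\in\mathbb{R}_{\max}$ and $\boldsymbol{x}=(x_1,\ldots,x_d)\in\mathbb{R}_{\max}^d$, $\lambda+\boldsymbol{x}$ denotes $(\lambda+x_1,\ldots,\lambda+x_d)$; the maximum of finitely many vectors is taken componentwise. The max-plus convex hull of points $\boldsymbol{x}_1,\ldots,\boldsymbol{x}_n\in\mathbb{R}_{\max}^d$ is the set of points $\boldsymbol{x}\in\mathbb{R}_{\max}^d$ for which there exist $\lambda_1,\ldots,\lambda_n\in\mathbb{R}_{\max}$ with $\max_{i}\lambda_i=0$ and $\boldsymbol{x}=\max_{i=1,\ldots,n}(\lambda_i+\boldsymbol{x}_i)$ (in particular the hull of the empty set is empty). A max-plus Tverberg partition of $X$ is a partition of $X$ into $q$ pairwise disjoint subsets $X_1,\ldots,X_q$ whose max-plus convex hulls have a common point; unordered means that partitions differing only by the order of the subsets are counted once. *)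

theory Defs
  imports "HOL-Analysis.Analysis" "HOL-Library.Disjoint_Sets"
begin

text \<open>
  \<open>\<real> \<union> {-\<infinity>}\<close> is rendered as the extended reals without \<open>\<infinity>\<close>. On this carrier the order and
  addition of \<open>ereal\<close> are the max-plus ones; in particular \<open>-\<infinity>\<close> is absorbing for addition
  (\<open>-\<infinity> + \<infinity> = \<infinity>\<close> on \<open>ereal\<close> is never reached).
\<close>

definition Rmax :: "ereal set" where
  "Rmax = {a. a \<noteq> \<infinity>}"

definition Rmax_vec :: "(ereal ^ 'd) set" where
  "Rmax_vec = {x. \<forall>i. x $ i \<in> Rmax}"

text \<open>
  The definition is meant for finite sets \<open>Y\<close>. As \<open>Max {}\<close> is unspecified, the
  condition \<open>Y \<noteq> {}\<close> makes the hull of the empty set empty.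
\<close>

definition maxplus_hull :: "(ereal ^ 'd) set \<Rightarrow> (ereal ^ 'd) set" where
  "maxplus_hull Y =
     {x \<in> Rmax_vec. Y \<noteq> {} \<and>
        (\<exists>l. (\<forall>y\<in>Y. l y \<in> Rmax) \<and> Max (l ` Y) = 0 \<and>
             x = (\<chi> i. Max ((\<lambda>y. l y + y $ i) ` Y)))}"

text \<open>
  An unordered partition is a set of blocks. The blocks of \<open>partition_on\<close> are nonempty, which
  excludes nothing here, since the hull of an empty block would be empty.
\<close>

definition maxplus_tverberg_partition ::
    "nat \<Rightarrow> (ereal ^ 'd) set \<Rightarrow> (ereal ^ 'd) set set \<Rightarrow> bool" where
  "maxplus_tverberg_partition q X P \<longleftrightarrow>
     partition_on X P \<and> card P = q \<and> (\<exists>x. \<forall>Y\<in>P. x \<in> maxplus_hull Y)"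

end

theory Submission
  imports Defs
begin

text \<open>
  Add a coordinate \<open>0\<close> on which every point has entry \<open>0\<close>. A point \<open>x\<close> lies in the hull of \<open>Y\<close>
  as soon as every coordinate \<open>i\<close>, including \<open>0\<close>, has some \<open>y \<in> Y\<close> with \<open>i \<in> argmax\<^sub>j (y\<^sub>j - x\<^sub>j)\<close>;
  let \<open>N i\<close> be the set of these \<open>y \<in> X\<close>. For real entries, choose \<open>x\<close> to be a minimiser of the
  convex function \<open>(d + 1) (\<Sum>y\<in>X. max\<^sub>j (y\<^sub>j - x\<^sub>j)) + |X| (\<Sum>j. x\<^sub>j)\<close>. Its directional
  derivatives give \<open>|X| |I| \<le> (d + 1) |N(I)|\<close>, hence \<open>|N(I)| \<ge> |I| (q - 1) + 1\<close>, for every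
  nonempty set \<open>I\<close> of coordinates. As in Lovasz's theorem on forest
  representatives, a minimal subsystem \<open>M\<close> with this property is a hypertree with edges of
  size \<open>q\<close>. It has exactly \<open>((q - 1)!)\<^sup>d\<close> proper \<open>q\<close>-colourings up to renaming the colours, since
  each new edge meets the previous ones in one point; the colour classes meet every \<open>M i\<close> and
  therefore have \<open>x\<close> in their hulls.
\<close>

section \<open>Convex minimisation for real entries\<close>

lemma continuous_on_Max_image:
  fixes f :: "'i \<Rightarrow> 'a::topological_space \<Rightarrow> 'b::linorder_topology"
  assumes "finite I" "I \<noteq> {}" "\<And>i. i \<in> I \<Longrightarrow> continuous_on S (f i)"
  shows "continuous_on S (\<lambda>x. Max ((\<lambda>i. f i x) ` I))"
  using assms
proof (induction I rule: finite_ne_induct)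
  case (insert i I)
  then show ?case
    by (simp add: continuous_on_max)
qed simp

text \<open>First-order optimality, with \<open>u\<close> playing the role of the negative of the
  minimising point. Raising the coordinates in \<open>I\<close> by a small \<open>e\<close> cannot
  lower the convex function. Its linear term drops by \<open>e * card X * card I\<close>, while the
  maximum for \<open>y\<close> grows by at most \<open>e\<close>, and only if it is attained at an
  index of \<open>I\<close>.\<close>

lemma exists_balanced_weights:
  fixes v :: "'a \<Rightarrow> 'c::finite \<Rightarrow> real"
  assumes "finite X"
  shows "\<exists>u. \<forall>I. card X * card I
    \<le> CARD('c) * card {y\<in>X. \<exists>i\<in>I. \<forall>j. v y j + u j \<le> v y i + u i}"
proof (cases "X = {}")
  case False
  define m where "m y u = Max (range (\<lambda>i. v y i + u $ i))" for y and u :: "real^'c"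
  \<comment> \<open>The coefficients \<open>CARD('c)\<close> and \<open>card X\<close> make \<Phi>
    invariant under adding a constant to all coordinates. Hence only vectors with largest coordinate
    0 have to be compared.\<close>
  define \<Phi> where "\<Phi> u = real CARD('c) * (\<Sum>y\<in>X. m y u) - real (card X) * (\<Sum>i\<in>UNIV. u $ i)"
    for u :: "real^'c"
  have m_ge: "v y i + u $ i \<le> m y u" for y i u
    unfolding m_def by (rule Max_ge) auto
  have m_le: "m y u \<le> a" if "\<And>i. v y i + u $ i \<le> a" for y u a
    unfolding m_def using that by (subst Max_le_iff) auto
  have m_attained: "\<exists>i. m y u = v y i + u $ i" for y u
  proof -
    have "m y u \<in> range (\<lambda>i. v y i + u $ i)"
      unfolding m_def by (rule Max_in) auto
    then show ?thesis by blast
  qed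
  have m_shift: "m y (u + (\<chi> i. a)) = m y u + a" for y u a
  proof (rule antisym)
    show "m y (u + (\<chi> i. a)) \<le> m y u + a"
      using m_ge[of y _ u] by (intro m_le) (simp add: algebra_simps)
    have "m y u \<le> m y (u + (\<chi> i. a)) - a"
      using m_ge[of y _ "u + (\<chi> i. a)"] by (intro m_le) (simp add: algebra_simps)
    then show "m y u + a \<le> m y (u + (\<chi> i. a))" by simp
  qed
  have \<Phi>_shift: "\<Phi> (u + (\<chi> i. a)) = \<Phi> u" for u a
    by (simp add: \<Phi>_def m_shift sum.distrib algebra_simps)
  have cont: "continuous_on UNIV \<Phi>"
    unfolding \<Phi>_def m_def by (intro continuous_intros continuous_on_Max_image) auto
  define V where "V = (\<Sum>y\<in>X. \<Sum>i\<in>UNIV. \<bar>v y i\<bar>)"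
  have V: "\<bar>v y i\<bar> \<le> V" if "y \<in> X" for y i
  proof -
    have "\<bar>v y i\<bar> \<le> (\<Sum>i\<in>UNIV. \<bar>v y i\<bar>)" by (intro member_le_sum) auto
    also have "\<dots> \<le> V" unfolding V_def using that assms
      by (intro member_le_sum) (auto intro: sum_nonneg)
    finally show ?thesis .
  qed
  have "V \<ge> 0" unfolding V_def by (intro sum_nonneg) auto
  \<comment> \<open>A coordinate below \<open>- R\<close> contributes at least
    \<open>2 * CARD('c) * card X * V\<close> to \<Phi>. One half offsets the lower bound on the
    maxima, the other half dominates \<open>\<Phi> 0\<close>.\<close>
  define R where "R = 2 * real CARD('c) * V"
  have "R \<ge> 0" using \<open>V \<ge> 0\<close> by (simp add: R_def)
  define B where "B = cbox (\<chi> i. - R) (0 :: real^'c)"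
  have B: "u \<in> B \<longleftrightarrow> (\<forall>i. - R \<le> u $ i \<and> u $ i \<le> 0)" for u
    by (simp add: B_def mem_box_cart)
  have "0 \<in> B" using \<open>R \<ge> 0\<close> by (simp add: B)
  moreover have "compact B" by (simp add: B_def)
  ultimately obtain u where "u \<in> B" and u: "\<And>z. z \<in> B \<Longrightarrow> \<Phi> u \<le> \<Phi> z"
    using continuous_attains_inf[of B \<Phi>] cont continuous_on_subset by blast
  have outside: "\<Phi> 0 \<le> \<Phi> z" if z: "z $ k = 0" "\<And>i. z $ i \<le> 0" "z \<notin> B" for z k
  proof -
    obtain j where "\<not> (- R \<le> z $ j \<and> z $ j \<le> 0)" using z(3) B[of z] by blast
    then have j: "z $ j < - R" using z(2)[of j] by linarith
    have "(\<Sum>i\<in>UNIV. z $ i) = z $ j + (\<Sum>i\<in>UNIV - {j}. z $ i)"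
      by (simp add: sum.remove)
    also have "\<dots> \<le> - R + 0"
      using j z(2) by (intro add_mono sum_nonpos) auto
    finally have "real (card X) * (\<Sum>i\<in>UNIV. z $ i) \<le> real (card X) * - R"
      by (intro mult_left_mono) auto
    also have "\<dots> = - 2 * (real CARD('c) * (real (card X) * V))" by (simp add: R_def)
    finally have z_sum: "real (card X) * (\<Sum>i\<in>UNIV. z $ i) \<le> \<dots>" .
    have "(\<Sum>y\<in>X. m y z) \<ge> (\<Sum>y\<in>X. - V)"
    proof (rule sum_mono)
      fix y assume "y \<in> X"
      then show "- V \<le> m y z" using m_ge[of y k z] V[of y k] z(1) by linarith
    qed
    then have "real CARD('c) * (\<Sum>y\<in>X. m y z) \<ge> real CARD('c) * (\<Sum>y\<in>X. - V)"
      by (intro mult_left_mono) auto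
    also have "real CARD('c) * (\<Sum>y\<in>X. - V) = - (real CARD('c) * (real (card X) * V))" by simp
    finally have m_z: "real CARD('c) * (\<Sum>y\<in>X. m y z) \<ge> \<dots>" .
    have "(\<Sum>y\<in>X. m y 0) \<le> (\<Sum>y\<in>X. V)"
      using V by (intro sum_mono m_le) (force dest: abs_le_D1)
    then have "real CARD('c) * (\<Sum>y\<in>X. m y 0) \<le> real CARD('c) * (\<Sum>y\<in>X. V)"
      by (intro mult_left_mono) auto
    also have "\<dots> = real CARD('c) * (real (card X) * V)" by simp
    finally have "\<Phi> 0 \<le> real CARD('c) * (real (card X) * V)" by (simp add: \<Phi>_def)
    then show ?thesis using z_sum m_z unfolding \<Phi>_def[of z] by linarith
  qed
  have min: "\<Phi> u \<le> \<Phi> z" for z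
  proof -
    define a where "a = Max (range (\<lambda>i. z $ i))"
    have "a \<in> range (\<lambda>i. z $ i)" unfolding a_def by (rule Max_in) auto
    then obtain k where k: "z $ k = a" by auto
    have a: "z $ i \<le> a" for i unfolding a_def by (rule Max_ge) auto
    have "\<Phi> u \<le> \<Phi> (z + (\<chi> i. - a))"
    proof (cases "z + (\<chi> i. - a) \<in> B")
      case False
      then have "\<Phi> 0 \<le> \<Phi> (z + (\<chi> i. - a))"
        using k a by (intro outside[of _ k]) auto
      then show ?thesis using u[OF \<open>0 \<in> B\<close>] by linarith
    qed (rule u)
    then show ?thesis by (simp only: \<Phi>_shift)
  qed
  have "card X * card I
    \<le> CARD('c) * card {y\<in>X. \<exists>i\<in>I. \<forall>j. v y j + u $ j \<le> v y i + u $ i}" (is "_ \<le> _ * card ?N") for I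
  proof -
    \<comment> \<open>For \<open>y\<close> outside \<open>?N\<close> no index of \<open>I\<close>
      attains the maximum. There are finitely many such gaps, all positive, so one \<open>e\<close>
      fits below all of them.\<close>
    have "\<forall>\<^sub>F e in at_right 0. \<forall>y\<in>X - ?N. \<forall>i\<in>I. v y i + u $ i + e \<le> m y u"
    proof (intro eventually_ball_finite ballI)
      fix y i assume y: "y \<in> X - ?N" "i \<in> I"
      then have "\<not> (\<forall>j. v y j + u $ j \<le> v y i + u $ i)" by blast
      then obtain j where "v y i + u $ i < v y j + u $ j" by (auto simp: not_le)
      then have "m y u - (v y i + u $ i) > 0" using m_ge[of y j u] by linarith
      then have "\<forall>\<^sub>F e in at_right 0. e < m y u - (v y i + u $ i)"
        unfolding eventually_at_right_field by blast
      then show "\<forall>\<^sub>F e in at_right 0. v y i + u $ i + e \<le> m y u"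
        by (rule eventually_mono) simp
    qed (use assms in auto)
    moreover have "\<forall>\<^sub>F e in at_right (0::real). e > 0" by (rule eventually_at_right_less)
    ultimately have "\<forall>\<^sub>F e in at_right 0. e > 0 \<and> (\<forall>y\<in>X - ?N. \<forall>i\<in>I. v y i + u $ i + e \<le> m y u)"
      by eventually_elim simp
    then have "\<exists>e. e > 0 \<and> (\<forall>y\<in>X - ?N. \<forall>i\<in>I. v y i + u $ i + e \<le> m y u)"
      by (rule eventually_happens'[rotated]) simp
    then obtain e where "e > 0"
      and e: "\<And>y i. y \<in> X - ?N \<Longrightarrow> i \<in> I \<Longrightarrow> v y i + u $ i + e \<le> m y u"
      by blast
    define z where "z = u + (\<chi> i. if i \<in> I then e else 0)"
    have "m y z \<le> m y u + (if y \<in> ?N then e else 0)" if "y \<in> X" for y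
      using m_ge[of y _ u] \<open>e > 0\<close> e that
      by (intro m_le) (auto simp: z_def algebra_simps intro: add_increasing)
    then have "(\<Sum>y\<in>X. m y z) \<le> (\<Sum>y\<in>X. m y u + (if y \<in> ?N then e else 0))"
      by (rule sum_mono)
    also have "\<dots> = (\<Sum>y\<in>X. m y u) + e * card ?N"
      using assms by (simp add: sum.distrib sum.If_cases Int_def conj_commute)
    finally have "real CARD('c) * (\<Sum>y\<in>X. m y z)
        \<le> real CARD('c) * ((\<Sum>y\<in>X. m y u) + e * card ?N)"
      by (intro mult_left_mono) auto
    moreover have "(\<Sum>i\<in>UNIV. z $ i) = (\<Sum>i\<in>UNIV. u $ i) + e * card I"
      by (simp add: z_def sum.distrib sum.If_cases)
    ultimately have "real (card X) * (e * card I) \<le> real CARD('c) * (e * card ?N)"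
      using min[of z] by (simp add: \<Phi>_def algebra_simps)
    then have "e * real (card X * card I) \<le> e * real (CARD('c) * card ?N)"
      by (simp add: algebra_simps)
    then show ?thesis using \<open>e > 0\<close> by (simp only: mult_le_cancel_left_pos of_nat_le_iff)
  qed
  then show ?thesis by blast
qed simp

section \<open>Contact patterns and the limit to entries -\<infinity>\<close>

text \<open>Sequential compactness of the extended reals, applied to one index at a time; this
  covers unbounded families as well.\<close>

lemma finite_family_convergent_subsequence:
  fixes f :: "nat \<Rightarrow> 'a \<Rightarrow> ereal"
  assumes "finite A"
  shows "\<exists>r l. strict_mono r \<and> (\<forall>a\<in>A. (\<lambda>n. f (r n) a) \<longlonglongrightarrow> l a)"
  using assms
proof induction
  case empty
  show ?case using strict_mono_id by blast
next
  case (insert a A)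
  then obtain r l where r: "strict_mono r" "\<And>b. b \<in> A \<Longrightarrow> (\<lambda>n. f (r n) b) \<longlonglongrightarrow> l b"
    by blast
  obtain k s where s: "strict_mono s" "((\<lambda>n. f (r n) a) \<circ> s) \<longlonglongrightarrow> k"
    using compact_complete_linorder[of "\<lambda>n. f (r n) a"] by blast
  have "(\<lambda>n. f ((r \<circ> s) n) b) \<longlonglongrightarrow> (l(a := k)) b" if "b \<in> insert a A" for b
  proof (cases "b = a")
    case True
    then show ?thesis using s(2) by (simp add: o_def)
  next
    case False
    then show ?thesis using that LIMSEQ_subseq_LIMSEQ[OF r(2) s(1), of b] by (simp add: o_def)
  qed
  moreover have "strict_mono (r \<circ> s)" using r(1) s(1) by (rule strict_mono_o)
  ultimately show ?case by blast
qed

text \<open>Let \<open>m y\<close> be the maximum of \<open>v y i + u i\<close>. Subtracting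
  \<open>m y\<close> turns attaining the maximum into an equality \<open>l y + v y i = x i\<close>
  with \<open>x i = - u i\<close>; adding \<open>u k\<close> to \<open>l\<close> and
  \<open>x\<close> normalises \<open>x k\<close> to 0.\<close>

lemma exists_balanced_contact_real:
  fixes v :: "'a \<Rightarrow> 'c::finite \<Rightarrow> real"
  assumes "finite X"
  shows "\<exists>l x. x k = 0 \<and> (\<forall>y i. l y + v y i \<le> x i) \<and>
    (\<forall>I. card X * card I \<le> CARD('c) * card {y\<in>X. \<exists>i\<in>I. l y + v y i = x i})"
proof -
  obtain u where u: "\<And>I. card X * card I
      \<le> CARD('c) * card {y\<in>X. \<exists>i\<in>I. \<forall>j. v y j + u j \<le> v y i + u i}"
    using exists_balanced_weights[OF assms, of v] by blast
  define m where "m y = Max (range (\<lambda>i. v y i + u i))" for y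
  have m_ge: "v y i + u i \<le> m y" for y i
    unfolding m_def by (rule Max_ge) auto
  have m_eq: "u k - m y + v y i = u k - u i"
    if "\<forall>j. v y j + u j \<le> v y i + u i" for y i
  proof -
    have "m y \<le> v y i + u i" unfolding m_def using that by (subst Max_le_iff) auto
    then show ?thesis using m_ge[of y i] by linarith
  qed
  have "card X * card I \<le> CARD('c) * card {y\<in>X. \<exists>i\<in>I. u k - m y + v y i = u k - u i}" for I
  proof -
    have "card {y\<in>X. \<exists>i\<in>I. \<forall>j. v y j + u j \<le> v y i + u i}
        \<le> card {y\<in>X. \<exists>i\<in>I. u k - m y + v y i = u k - u i}"
      by (intro card_mono) (use assms m_eq in auto)
    then show ?thesis using u[of I] by (meson le_trans mult_le_mono2)
  qed
  moreover have "u k - m y + v y i \<le> u k - u i" for y i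
    using m_ge[of y i] by linarith
  ultimately show ?thesis
    by (intro exI[of _ "\<lambda>y. u k - m y"] exI[of _ "\<lambda>i. u k - u i"]) auto
qed

text \<open>
  Entries \<open>-\<infinity>\<close> are replaced by \<open>-n\<close>; some contact pattern occurs for infinitely many \<open>n\<close>, and
  along a subsequence of these \<open>n\<close> the scalars converge in the compact space \<open>ereal\<close>.
\<close>
lemma exists_balanced_contact:
  fixes w :: "'a \<Rightarrow> 'c::finite \<Rightarrow> ereal"
  assumes "finite X" "X \<noteq> {}"
    and w: "\<And>y i. y \<in> X \<Longrightarrow> w y i \<noteq> \<infinity>" "\<And>y. y \<in> X \<Longrightarrow> w y k = 0"
  obtains N l x where "x k = 0" "\<And>y i. y \<in> X \<Longrightarrow> l y + w y i \<le> x i"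
    "\<And>i. N i \<subseteq> X" "\<And>i y. y \<in> N i \<Longrightarrow> l y + w y i = x i"
    "\<And>I. card X * card I \<le> CARD('c) * card (\<Union>i\<in>I. N i)"
proof -
  define v where "v n y i = (if w y i = -\<infinity> then - real n else real_of_ereal (w y i))" for n y i
  have v_lim: "(\<lambda>n. ereal (v n y i)) \<longlonglongrightarrow> w y i" if "y \<in> X" for y i
  proof (cases "w y i")
    case MInf
    have "(\<lambda>n. ereal (- real n)) \<longlonglongrightarrow> -\<infinity>"
      unfolding tendsto_MInfty
    proof
      fix b :: real
      obtain a :: nat where "- b < a" using reals_Archimedean2 by blast
      then have "ereal (- real n) < ereal b" if "n \<ge> a" for n
        using that by simp
      then show "\<forall>\<^sub>F n in sequentially. ereal (- real n) < ereal b"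
        unfolding eventually_sequentially by blast
    qed
    then show ?thesis using MInf by (simp add: v_def)
  qed (use w that in \<open>auto simp: v_def\<close>)
  define P where "P n l x \<longleftrightarrow> x k = 0 \<and> (\<forall>y i. l y + v n y i \<le> x i) \<and>
      (\<forall>I. card X * card I \<le> CARD('c) * card {y\<in>X. \<exists>i\<in>I. l y + v n y i = x i})" for n l x
  have "\<exists>l x. P n l x" for n
    unfolding P_def by (rule exists_balanced_contact_real[OF \<open>finite X\<close>])
  then obtain l x where P: "\<And>n. P n (l n) (x n)" by metis
  then have x: "\<And>n. x n k = 0" and le: "\<And>n y i. l n y + v n y i \<le> x n i"
    and card: "\<And>n I. card X * card I \<le> CARD('c) * card {y\<in>X. \<exists>i\<in>I. l n y + v n y i = x n i}"
    unfolding P_def by blast+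
  define E where "E n i = {y\<in>X. l n y + v n y i = x n i}" for n i
  have "finite (range E)"
  proof (rule finite_subset)
    show "range E \<subseteq> Pi\<^sub>E UNIV (\<lambda>_. Pow X)" by (auto simp: E_def)
    show "finite (Pi\<^sub>E (UNIV :: 'c set) (\<lambda>_. Pow X))" by (intro finite_PiE) (use assms in auto)
  qed
  then obtain n0 where inf: "infinite {n. E n = E n0}"
    using pigeonhole_infinite[of UNIV E] by auto
  define N where "N = E n0"
  obtain s :: "nat \<Rightarrow> nat" where s: "strict_mono s" "\<And>n. E (s n) = N"
    using infinite_enumerate[OF inf] by (auto simp: N_def)
  obtain r L where r: "strict_mono r"
    and L: "\<And>y. y \<in> X \<Longrightarrow> (\<lambda>n. ereal (l (s (r n)) y)) \<longlonglongrightarrow> L y"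
    using finite_family_convergent_subsequence[OF \<open>finite X\<close>, of "\<lambda>n y. ereal (l (s n) y)"] by blast
  have v_lim': "(\<lambda>n. ereal (v (s (r n)) y i)) \<longlonglongrightarrow> w y i" if "y \<in> X" for y i
    using LIMSEQ_subseq_LIMSEQ[OF v_lim[OF that] strict_mono_o[OF s(1) r]] by (simp add: o_def)
  \<comment> \<open>At index \<open>k\<close> both the entry and \<open>x n k\<close> are 0. The
    bound keeps \<open>L y\<close> away from \<infinity>, so addition on \<open>ereal\<close> is
    continuous at the limit even when a summand tends to -\<infinity>.\<close>
  have "l n y \<le> 0" if "y \<in> X" for n y
    using le[of n y k] x w(2)[OF that] by (simp add: v_def)
  then have L_le: "L y \<le> 0" if "y \<in> X" for y
    using that by (intro LIMSEQ_le_const2[OF L]) auto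
  have sum_lim: "(\<lambda>n. ereal (l (s (r n)) y + v (s (r n)) y i)) \<longlonglongrightarrow> L y + w y i" if "y \<in> X" for y i
  proof -
    have "L y \<noteq> \<infinity>" "w y i \<noteq> \<infinity>" using L_le[OF that] w(1)[OF that] by auto
    then show ?thesis
      using tendsto_add_ereal_general[OF _ L[OF that] v_lim'[OF that], of i] by simp
  qed
  have card_N: "card X * card I \<le> CARD('c) * card (\<Union>i\<in>I. N i)" for I
  proof -
    have "{y\<in>X. \<exists>i\<in>I. l n0 y + v n0 y i = x n0 i} = (\<Union>i\<in>I. N i)" by (auto simp: N_def E_def)
    then show ?thesis using card[of I n0] by simp
  qed
  have "N i \<noteq> {}" for i
    using card_N[of "{i}"] assms(1,2) by (auto simp: card_gt_0_iff)
  then obtain p where p: "\<And>i. p i \<in> N i" by (meson all_not_in_conv)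
  have NX: "N i \<subseteq> X" for i by (auto simp: N_def E_def)
  \<comment> \<open>The subsequence was extracted for the scalars only. The coordinates
    \<open>x\<close> converge along it because \<open>p i\<close> is a contact point at every index
    \<open>s n\<close>.\<close>
  define z where "z i = L (p i) + w (p i) i" for i
  have z_lim: "(\<lambda>n. ereal (x (s (r n)) i)) \<longlonglongrightarrow> z i" for i
  proof -
    have "l (s n) (p i) + v (s n) (p i) i = x (s n) i" for n
      using p[of i] s(2)[of n] by (auto simp: E_def)
    then show ?thesis using sum_lim[of "p i" i] p NX by (auto simp: z_def)
  qed
  have "z k = 0"
    using z_lim[of k] x by (simp add: LIMSEQ_const_iff zero_ereal_def)
  moreover have "L y + w y i \<le> z i" if "y \<in> X" for y i
    using le by (intro LIMSEQ_le[OF sum_lim[OF that] z_lim]) auto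
  moreover have "L y + w y i = z i" if "y \<in> N i" for y i
  proof -
    have "l (s n) y + v (s n) y i = x (s n) i" for n
      using that s(2)[of n] by (auto simp: E_def)
    then show ?thesis using sum_lim[of y i] that NX by (intro LIMSEQ_unique[OF _ z_lim[of i]]) auto
  qed
  ultimately show thesis by (intro that[OF _ _ NX _ card_N])
qed

section \<open>Reduction to a system of edges of size \<open>r + 1\<close>\<close>

text \<open>
  In an edge-minimal system the intersection \<open>T\<close> of all tight sets containing \<open>i\<close> is tight, and
  criticality of the edges at \<open>i\<close> makes \<open>M i\<close> disjoint from the other sets indexed by \<open>T\<close>;
  counting then forces \<open>T = {i}\<close>.
\<close>
lemma exists_uniform_subsystem:
  fixes N :: "'c::finite \<Rightarrow> 'a set"
  assumes fin: "\<And>i. finite (N i)"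
    and hall: "\<And>I. I \<noteq> {} \<Longrightarrow> card I * r < card (\<Union>i\<in>I. N i)"
  shows "\<exists>M. (\<forall>i. M i \<subseteq> N i \<and> card (M i) = Suc r) \<and>
    (\<forall>I. I \<noteq> {} \<longrightarrow> card I * r < card (\<Union>i\<in>I. M i))"
proof -
  define Q where "Q M \<longleftrightarrow> (\<forall>i. M i \<subseteq> N i) \<and> (\<forall>I. I \<noteq> {} \<longrightarrow> card I * r < card (\<Union>i\<in>I. M i))"
    for M
  have "Q N" using hall by (auto simp: Q_def)
  then obtain M where M: "Q M" and least: "\<And>M'. Q M' \<Longrightarrow> (\<Sum>i\<in>UNIV. card (M i)) \<le> (\<Sum>i\<in>UNIV. card (M' i))"
    using ex_has_least_nat[of Q N "\<lambda>M. \<Sum>i\<in>UNIV. card (M i)"] by blast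
  have M_hall: "card I * r < card (\<Union>i\<in>I. M i)" if "I \<noteq> {}" for I
    using M that by (auto simp: Q_def)
  have M_sub: "M i \<subseteq> N i" for i using M by (auto simp: Q_def)
  have finM: "finite (M i)" for i using M_sub fin finite_subset by blast
  \<comment> \<open>By minimality, deleting \<open>y\<close> from \<open>M i\<close> violates the
    inequality for some \<open>I\<close>. The deletion must shrink the union over \<open>I\<close>,
    so \<open>i\<close> is in \<open>I\<close> and no other set of \<open>I\<close> contains
    \<open>y\<close>; only one vertex is lost, so \<open>I\<close> was tight.\<close>
  have critical: "\<exists>I. i \<in> I \<and> card (\<Union>j\<in>I. M j) = Suc (card I * r) \<and> y \<notin> (\<Union>j\<in>I - {i}. M j)"
    if y: "y \<in> M i" for i y
  proof -
    let ?M = "M(i := M i - {y})"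
    have "(\<Sum>j\<in>UNIV. card (?M j)) < (\<Sum>j\<in>UNIV. card (M j))"
    proof (rule sum_strict_mono_ex1)
      show "\<forall>j\<in>UNIV. card (?M j) \<le> card (M j)"
        using finM by (auto intro: card_mono)
      show "\<exists>j\<in>UNIV. card (?M j) < card (M j)"
        using card_Diff1_less[OF finM y] by (intro bexI[of _ i]) auto
    qed simp
    then have "\<not> Q ?M" using least by (meson linorder_not_le)
    moreover have "\<forall>j. ?M j \<subseteq> N j" using M_sub by auto
    ultimately obtain I where I: "I \<noteq> {}" "\<not> card I * r < card (\<Union>j\<in>I. ?M j)"
      by (auto simp: Q_def)
    have "i \<in> I"
    proof (rule ccontr)
      assume "i \<notin> I"
      then have "(\<Union>j\<in>I. ?M j) = (\<Union>j\<in>I. M j)" by auto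
      then show False using I M_hall by auto
    qed
    have "y \<notin> (\<Union>j\<in>I - {i}. M j)"
    proof
      assume "y \<in> (\<Union>j\<in>I - {i}. M j)"
      then have "(\<Union>j\<in>I. ?M j) = (\<Union>j\<in>I. M j)" by (auto split: if_splits)
      then show False using I M_hall by auto
    qed
    moreover have "card (\<Union>j\<in>I. M j) \<le> Suc (card (\<Union>j\<in>I. ?M j))"
    proof -
      have "(\<Union>j\<in>I. M j) \<subseteq> insert y (\<Union>j\<in>I. ?M j)" by (auto split: if_splits)
      then have "card (\<Union>j\<in>I. M j) \<le> card (insert y (\<Union>j\<in>I. ?M j))"
        using finM by (intro card_mono) auto
      also have "\<dots> \<le> Suc (card (\<Union>j\<in>I. ?M j))" by (rule card_insert_le_m1) auto
      finally show ?thesis .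
    qed
    ultimately show ?thesis using \<open>i \<in> I\<close> I M_hall[of I] by (intro exI[of _ I]) auto
  qed
  define tight where "tight I \<longleftrightarrow> card (\<Union>j\<in>I. M j) = Suc (card I * r)" for I
  \<comment> \<open>Submodularity of the size of the union: the excesses over
    \<open>card I * r\<close> at the intersection and the union add up to at most 2, and each is at
    least 1.\<close>
  have tight_Int: "tight (I \<inter> J)" if I: "tight I" and J: "tight J" and "I \<inter> J \<noteq> {}" for I J
  proof -
    let ?U = "\<lambda>I. \<Union>j\<in>I. M j"
    have fU: "finite (?U I)" for I using finM by auto
    have "card (?U (I \<inter> J)) + card (?U (I \<union> J)) \<le> card (?U I \<inter> ?U J) + card (?U I \<union> ?U J)"
      using fU by (intro add_mono card_mono) auto
    also have "\<dots> = card (?U I) + card (?U J)"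
      using card_Un_Int[OF fU fU, of I J] by simp
    also have "\<dots> = Suc (Suc ((card I + card J) * r))"
      using I J by (simp add: tight_def algebra_simps)
    also have "card I + card J = card (I \<inter> J) + card (I \<union> J)"
      using card_Un_Int[of I J] by simp
    finally have "card (?U (I \<inter> J)) + card (?U (I \<union> J))
        \<le> Suc (Suc (card (I \<inter> J) * r + card (I \<union> J) * r))" by (simp add: algebra_simps)
    moreover have "card (I \<inter> J) * r < card (?U (I \<inter> J))" "card (I \<union> J) * r < card (?U (I \<union> J))"
      by (rule M_hall; use that in blast)+
    ultimately show ?thesis unfolding tight_def by linarith
  qed
  have "card (M i) = Suc r" for i
  proof -
    define T where "T = \<Inter>{I. i \<in> I \<and> tight I}"
    have Inter: "i \<in> \<Inter>F \<and> tight (\<Inter>F)" if "finite F" "F \<noteq> {}" "\<And>I. I \<in> F \<Longrightarrow> i \<in> I \<and> tight I" for F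
      using that
    proof (induction F rule: finite_ne_induct)
      case (insert I F)
      then show ?case using tight_Int[of I "\<Inter>F"] by auto
    qed auto
    obtain y where "y \<in> M i" using M_hall[of "{i}"] by fastforce
    then obtain I where "i \<in> I" "tight I" using critical[of y i] by (auto simp: tight_def)
    then have "i \<in> T \<and> tight T"
      unfolding T_def by (intro Inter) auto
    then have T: "i \<in> T" "tight T" by auto
    \<comment> \<open>The critical tight set of a vertex \<open>y\<close> of \<open>M i\<close>
      contains \<open>T\<close>, so the other sets indexed by \<open>T\<close> avoid
      \<open>y\<close> too.\<close>
    have disj: "M i \<inter> (\<Union>j\<in>T - {i}. M j) = {}"
    proof (rule ccontr)
      assume "M i \<inter> (\<Union>j\<in>T - {i}. M j) \<noteq> {}"
      then obtain y where y: "y \<in> M i" "y \<in> (\<Union>j\<in>T - {i}. M j)" by blast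
      from critical[OF y(1)] obtain I where "i \<in> I" "tight I" "y \<notin> (\<Union>j\<in>I - {i}. M j)"
        by (auto simp: tight_def)
      then show False using y(2) by (auto simp: T_def)
    qed
    have "(\<Union>j\<in>T. M j) = M i \<union> (\<Union>j\<in>T - {i}. M j)" using T(1) by auto
    then have "card (\<Union>j\<in>T. M j) = card (M i) + card (\<Union>j\<in>T - {i}. M j)"
      using disj finM by (simp add: card_Un_disjoint)
    moreover have "card (M i) > r" using M_hall[of "{i}"] by simp
    moreover have "card T = Suc (card (T - {i}))" using T(1) by (metis card_Suc_Diff1 finite)
    \<comment> \<open>Otherwise the disjoint parts \<open>M i\<close> and the rest would each have
      excess at least 1, giving \<open>T\<close> excess at least 2.\<close>
    ultimately have "T - {i} = {}" using T(2) M_hall[of "T - {i}"] by (force simp: tight_def)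
    then have "T = {i}" using T(1) by auto
    then show ?thesis using T(2) by (simp add: tight_def)
  qed
  then show ?thesis using M_sub M_hall by blast
qed

section \<open>Counting colourings and their colour classes\<close>

lemma card_inj_PiE:
  assumes "finite S" "finite T" "card S = card T"
  shows "card {f \<in> S \<rightarrow>\<^sub>E T. inj_on f S} = fact (card T)"
  using assms
proof (induction S arbitrary: T rule: finite_induct)
  case empty
  then show ?case by (simp add: conj_commute Collect_conv_if)
next
  case (insert x S)
  let ?E = "\<lambda>y. {g \<in> S \<rightarrow>\<^sub>E (T - {y}). inj_on g S}"
  have E: "card (?E y) = fact (card T - 1)" if "y \<in> T" for y
    using insert.IH[of "T - {y}"] insert.prems insert.hyps that by (simp add: card_insert_if)
  have "{f \<in> insert x S \<rightarrow>\<^sub>E T. inj_on f (insert x S)} = (\<lambda>(y, g). g(x := y)) ` Sigma T ?E"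
    by (subst extensional_funcset_extend_domain_inj_on_eq[OF insert.hyps(2)])
      (intro arg_cong[where f = "\<lambda>A. _ ` A"], auto)
  moreover have "inj_on (\<lambda>(y, g). g(x := y)) (Sigma T ?E)"
    using extensional_funcset_extend_domain_inj_onI[OF insert.hyps(2), of T]
    by (rule inj_on_subset) auto
  ultimately have "card {f \<in> insert x S \<rightarrow>\<^sub>E T. inj_on f (insert x S)} = card (Sigma T ?E)"
    by (simp add: card_image)
  also have "\<dots> = (\<Sum>y\<in>T. card (?E y))"
    using insert.prems(1) insert.hyps(1)
    by (intro card_SigmaI) (auto intro!: finite_subset[OF _ finite_PiE[of S "\<lambda>_. T"]])
  also have "\<dots> = card T * fact (card T - 1)"
    using E by simp
  also have "\<dots> = fact (card T)"
    using insert.prems insert.hyps by (simp add: fact_reduce)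
  finally show ?case .
qed

text \<open>
  The index set is enlarged one element at a time along intersecting sets. Every new set meets
  the union of the previous ones in a single vertex, so its colours can be completed in
  \<open>r!\<close> ways.
\<close>
lemma card_rainbow_colourings:
  fixes M :: "'c::finite \<Rightarrow> 'a set"
  assumes card_M: "\<And>i. card (M i) = Suc r"
    and hall: "\<And>I. I \<noteq> {} \<Longrightarrow> card I * r < card (\<Union>i\<in>I. M i)"
    and total: "card (\<Union>i. M i) = Suc (CARD('c) * r)"
  shows "fact r ^ (CARD('c) - 1)
    \<le> card {c \<in> (\<Union>i. M i) \<rightarrow>\<^sub>E M i0. (\<forall>y\<in>M i0. c y = y) \<and> (\<forall>i. inj_on c (M i))}"
proof -
  define U where "U A = (\<Union>i\<in>A. M i)" for A
  \<comment> \<open>Colours are the vertices of \<open>M i0\<close>, each coloured by itself; this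
    fixes the names of the colours.\<close>
  define F where "F A = {c \<in> U A \<rightarrow>\<^sub>E M i0. (\<forall>y\<in>M i0. c y = y) \<and> (\<forall>i\<in>A. inj_on c (M i))}" for A
  have finM: "finite (M i)" for i using card_M[of i] by (metis card.infinite nat.distinct(1))
  have finU: "finite (U A)" for A using finM by (simp add: U_def)
  have finF: "finite (F A)" for A
    unfolding F_def by (rule finite_subset[OF _ finite_PiE[of "U A" "\<lambda>_. M i0"]]) (auto simp: finU finM)
  have "\<exists>A. i0 \<in> A \<and> card A = Suc k \<and> card (U A) = Suc (Suc k * r) \<and> fact r ^ k \<le> card (F A)"
    if "k < CARD('c)" for k
    using that
  proof (induction k)
    case 0
    have "restrict id (M i0) \<in> F {i0}" by (auto simp: F_def U_def inj_on_def)
    then have "1 \<le> card (F {i0})"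
      using finF by (metis One_nat_def Suc_leI card_gt_0_iff empty_iff)
    then show ?case using card_M by (intro exI[of _ "{i0}"]) (auto simp: U_def)
  next
    case (Suc k)
    then obtain A where A: "i0 \<in> A" "card A = Suc k" "card (U A) = Suc (Suc k * r)"
        "fact r ^ k \<le> card (F A)" by auto
    have "A \<noteq> UNIV" using A(2) Suc.prems by auto
    then have "- A \<noteq> {}" by blast
    \<comment> \<open>If nothing outside \<open>A\<close> met \<open>U A\<close>, the two disjoint
      unions would together have at least \<open>CARD('c) * r + 2\<close> vertices, one more than
      \<open>total\<close> allows.\<close>
    have "\<exists>j\<in>- A. M j \<inter> U A \<noteq> {}"
    proof (rule ccontr)
      assume "\<not> ?thesis"
      then have "U A \<inter> U (- A) = {}" by (auto simp: U_def)
      then have "card (U A \<union> U (- A)) = card (U A) + card (U (- A))"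
        by (intro card_Un_disjoint finU)
      moreover have "U A \<union> U (- A) = (\<Union>i. M i)" by (auto simp: U_def)
      ultimately have "Suc (CARD('c) * r) = Suc (card A * r) + card (U (- A))"
        using total A(2,3) by simp
      moreover have "card (- A) * r < card (U (- A))"
        using hall[OF \<open>- A \<noteq> {}\<close>] by (simp add: U_def)
      moreover have "CARD('c) = card A + card (- A)"
        using card_Un_disjoint[of A "- A"] by (simp add: Compl_partition)
      ultimately show False by (simp add: algebra_simps)
    qed
    then obtain j where j: "j \<notin> A" "M j \<inter> U A \<noteq> {}" by auto
    let ?B = "insert j A"
    have UB: "U ?B = M j \<union> U A" by (auto simp: U_def)
    have cardB: "card ?B = Suc (Suc k)" using j(1) A(2) by simp
    \<comment> \<open>The left side is \<open>Suc (Suc k) * r + 2\<close> and the new union has more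
      than \<open>Suc (Suc k) * r\<close> vertices, so at most one vertex is shared.\<close>
    have "card (M j) + card (U A) = card (U ?B) + card (M j \<inter> U A)"
      unfolding UB using finM finU by (intro card_Un_Int)
    moreover have "Suc (Suc k) * r < card (U ?B)"
      using hall[of ?B] cardB by (simp add: U_def)
    moreover have "card (M j \<inter> U A) > 0" using j(2) finM by (simp add: card_gt_0_iff)
    ultimately have "card (M j \<inter> U A) = 1" and cardUB: "card (U ?B) = Suc (Suc (Suc k) * r)"
      using A(3) card_M[of j] by (auto simp: algebra_simps)
    then obtain v where v: "M j \<inter> U A = {v}" by (auto simp: card_1_singleton_iff)
    \<comment> \<open>The shared vertex \<open>v\<close> already has its colour; the other
      \<open>r\<close> vertices of \<open>M j\<close> receive the remaining \<open>r\<close> colours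
      bijectively.\<close>
    define E where "E c = {g \<in> (M j - {v}) \<rightarrow>\<^sub>E (M i0 - {c v}). inj_on g (M j - {v})}" for c :: "'a \<Rightarrow> 'a"
    define h where "h = (\<lambda>(c, g) y. if y \<in> U A then c y else g y :: 'a)"
    have cv: "c v \<in> M i0" if "c \<in> F A" for c using that v by (auto simp: F_def)
    have card_E: "card (E c) = fact r" if "c \<in> F A" for c
    proof -
      have "v \<in> M j" using v by blast
      then have "card (M j - {v}) = r" "card (M i0 - {c v}) = r"
        using cv[OF that] card_M by (simp_all add: card_Diff_singleton)
      then show ?thesis
        unfolding E_def using card_inj_PiE[of "M j - {v}" "M i0 - {c v}"] finM by simp
    qed
    have h_in: "h (c, g) \<in> F ?B" if c: "c \<in> F A" and g: "g \<in> E c" for c g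
    proof -
      have out: "y \<notin> U A" if "y \<in> M j - {v}" for y using that v by blast
      have hU: "h (c, g) y = c y" if "y \<in> U A" for y using that by (simp add: h_def)
      have hM: "h (c, g) y = g y" if "y \<in> M j - {v}" for y using out[OF that] by (simp add: h_def)
      have "M i \<subseteq> U A" if "i \<in> A" for i using that by (auto simp: U_def)
      then have old: "inj_on (h (c, g)) (M i)" if "i \<in> A" for i
        using c that hU by (auto simp: F_def inj_on_def subset_iff)
      have "M j = insert v (M j - {v})" using v by auto
      moreover have "inj_on (h (c, g)) (insert v (M j - {v}))"
      proof -
        have "inj_on (h (c, g)) (M j - {v})"
          using g hM by (simp add: E_def inj_on_def)
        moreover have "h (c, g) v \<notin> h (c, g) ` (M j - {v})"
        proof -
          have "h (c, g) v = c v" using hU v by blast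
          moreover have "g y \<noteq> c v" if "y \<in> M j - {v}" for y
            using g that by (auto simp: E_def PiE_iff)
          ultimately show ?thesis using hM by force
        qed
        ultimately show ?thesis unfolding inj_on_insert by simp
      qed
      ultimately have new: "inj_on (h (c, g)) (M j)" by metis
      have "h (c, g) \<in> U ?B \<rightarrow>\<^sub>E M i0"
      proof (rule PiE_I)
        fix y assume "y \<in> U ?B"
        then consider "y \<in> U A" | "y \<in> M j - {v}" using v UB by blast
        then show "h (c, g) y \<in> M i0"
        proof cases
          case 1
          then show ?thesis using c hU by (auto simp: F_def)
        next
          case 2
          then show ?thesis using g hM by (auto simp: E_def PiE_iff)
        qed
      next
        fix y assume "y \<notin> U ?B"
        then show "h (c, g) y = undefined"
          using g UB by (auto simp: h_def E_def PiE_iff extensional_def)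
      qed
      moreover have "h (c, g) y = y" if "y \<in> M i0" for y
      proof -
        have "y \<in> U A" using that A(1) by (auto simp: U_def)
        then show ?thesis using c that hU by (auto simp: F_def)
      qed
      ultimately show ?thesis using old new by (auto simp: F_def)
    qed
    have "inj_on h (Sigma (F A) E)"
    proof (rule inj_onI, clarify)
      fix c g c' g' assume *: "c \<in> F A" "g \<in> E c" "c' \<in> F A" "g' \<in> E c'" "h (c, g) = h (c', g')"
      have "c y = c' y" for y
      proof (cases "y \<in> U A")
        case True
        then show ?thesis using fun_cong[OF *(5), of y] by (simp add: h_def)
      next
        case False
        then show ?thesis using *(1,3) by (auto simp: F_def PiE_iff extensional_def)
      qed
      moreover have "g y = g' y" for y
      proof (cases "y \<in> M j - {v}")
        case True
        then have "y \<notin> U A" using v by blast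
        then show ?thesis using fun_cong[OF *(5), of y] by (simp add: h_def)
      next
        case False
        then show ?thesis using *(2,4) by (auto simp: E_def PiE_iff extensional_def)
      qed
      ultimately show "c = c' \<and> g = g'" by auto
    qed
    then have "card (Sigma (F A) E) \<le> card (F ?B)"
      using h_in finF by (intro card_inj_on_le[of h]) auto
    moreover have "card (Sigma (F A) E) = card (F A) * fact r"
    proof -
      have "finite (E c)" if "c \<in> F A" for c
        using card_E[OF that] by (metis card.infinite fact_nonzero)
      then have "card (Sigma (F A) E) = (\<Sum>c\<in>F A. card (E c))"
        using finF by (intro card_SigmaI) auto
      then show ?thesis using card_E by simp
    qed
    moreover have "fact r ^ k * fact r \<le> card (F A) * fact r"
      using A(4) by (rule mult_le_mono1)
    ultimately have "fact r ^ Suc k \<le> card (F ?B)" unfolding power_Suc2 by linarith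
    then show ?case using A(1) cardB cardUB by blast
  qed
  from this[of "CARD('c) - 1"] obtain A where "card A = CARD('c)" "fact r ^ (CARD('c) - 1) \<le> card (F A)"
    by auto
  then show ?thesis using card_eq_UNIV_imp_eq_UNIV[of A] by (simp add: F_def U_def)
qed

text \<open>
  Taking the elements of \<open>M i0\<close> themselves as colours, a colouring is determined by the
  partition into its colour classes.
\<close>
lemma card_transversal_partitions:
  fixes M :: "'c::finite \<Rightarrow> 'a set"
  assumes card_M: "\<And>i. card (M i) = Suc r"
    and hall: "\<And>I. I \<noteq> {} \<Longrightarrow> card I * r < card (\<Union>i\<in>I. M i)"
    and total: "card (\<Union>i. M i) = Suc (CARD('c) * r)"
  shows "fact r ^ (CARD('c) - 1)
    \<le> card {P. partition_on (\<Union>i. M i) P \<and> card P = Suc r \<and> (\<forall>Y\<in>P. \<forall>i. Y \<inter> M i \<noteq> {})}"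
    (is "_ \<le> card ?Ps")
proof -
  define X where "X = (\<Union>i. M i)"
  \<comment> \<open>\<open>undefined\<close> serves as an arbitrary index.\<close>
  define i0 :: 'c where "i0 = undefined"
  define F where "F = {c \<in> X \<rightarrow>\<^sub>E M i0. (\<forall>y\<in>M i0. c y = y) \<and> (\<forall>i. inj_on c (M i))}"
  define classes where "classes c = (\<lambda>a. {y\<in>X. c y = a}) ` M i0" for c :: "'a \<Rightarrow> 'a"
  have finM: "finite (M i)" for i using card_M[of i] by (metis card.infinite nat.distinct(1))
  have finX: "finite X" using finM by (simp add: X_def)
  have MX: "M i \<subseteq> X" for i by (auto simp: X_def)
  have c_in: "c y \<in> M i0" if "c \<in> F" "y \<in> X" for c y using that by (auto simp: F_def)
  have c_id: "c y = y" if "c \<in> F" "y \<in> M i0" for c y using that by (auto simp: F_def)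
  have "classes c \<in> ?Ps" if c: "c \<in> F" for c
  proof -
    have surj: "c ` M i = M i0" for i
    proof (rule card_subset_eq)
      show "c ` M i \<subseteq> M i0" using c_in[OF c] MX[of i] by auto
      show "card (c ` M i) = card (M i0)"
        using c card_M by (simp add: F_def card_image)
    qed (rule finM)
    have meets: "{y\<in>X. c y = a} \<inter> M i \<noteq> {}" if "a \<in> M i0" for a i
    proof -
      have "a \<in> c ` M i" unfolding surj by (rule that)
      then show ?thesis using MX[of i] by auto
    qed
    have "partition_on X (classes c)"
    proof (rule partition_onI)
      show "\<Union> (classes c) = X" using c_in[OF c] by (auto simp: classes_def)
      show "{} \<notin> classes c" using meets[of _ i0] by (force simp: classes_def)
    qed (auto simp: classes_def disjnt_def)
    moreover have "inj_on (\<lambda>a. {y\<in>X. c y = a}) (M i0)"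
    proof (rule inj_onI)
      fix a b assume "a \<in> M i0" "b \<in> M i0" and eq: "{y\<in>X. c y = a} = {y\<in>X. c y = b}"
      then obtain y where "y \<in> {y\<in>X. c y = a}" using meets[of a i0] by blast
      then show "a = b" using eq by auto
    qed
    then have "card (classes c) = Suc r" by (simp add: classes_def card_image card_M)
    ultimately show ?thesis using meets by (auto simp: classes_def X_def)
  qed
  moreover have "inj_on classes F"
  proof (rule inj_onI)
    fix c c' assume c: "c \<in> F" "c' \<in> F" and eq: "classes c = classes c'"
    show "c = c'"
    proof
      fix y
      show "c y = c' y"
      proof (cases "y \<in> X")
        case True
        define a where "a = c y"
        have a: "a \<in> M i0" using c_in[OF c(1) True] by (simp add: a_def)
        then have "{y\<in>X. c y = a} \<in> classes c'"
          unfolding eq[symmetric] by (simp add: classes_def)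
        then obtain b where b: "{y\<in>X. c y = a} = {y\<in>X. c' y = b}" by (auto simp: classes_def)
        \<comment> \<open>The colour \<open>a\<close> of \<open>y\<close> is itself a vertex in the
          class of \<open>y\<close>. Both colourings fix \<open>a\<close>, so \<open>c'\<close> also
          gives the colour \<open>a\<close> to this class.\<close>
        have "a \<in> {y\<in>X. c y = a}" "y \<in> {y\<in>X. c y = a}"
          using a c_id[OF c(1) a] MX[of i0] True by (auto simp: a_def)
        then have "c' a = b" "c' y = b" unfolding b by auto
        then show ?thesis using c_id[OF c(2) a] by (simp add: a_def)
      next
        case False
        then show ?thesis using c by (auto simp: F_def PiE_iff extensional_def)
      qed
    qed
  qed
  moreover have "finite ?Ps"
    by (rule finite_subset[of _ "Pow (Pow X)"]) (auto simp: X_def[symmetric] partition_on_def finX)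
  ultimately have "card F \<le> card ?Ps" by (intro card_inj_on_le[of classes]) auto
  moreover have "fact r ^ (CARD('c) - 1) \<le> card F"
    unfolding F_def X_def by (rule card_rainbow_colourings[OF assms])
  ultimately show ?thesis by linarith
qed

section \<open>From transversal partitions to max-plus hulls\<close>

theorem theorem12:
  fixes q :: nat and X :: "(ereal ^ 'd) set"
  assumes "q \<ge> 2"
    and "X \<subseteq> Rmax_vec"
    and "card X = (CARD('d) + 1) * (q - 1) + 1"
  shows "card {P. maxplus_tverberg_partition q X P} \<ge> (fact (q - 1)) ^ CARD('d)"
proof -
  define r where "r = q - 1"
  have q: "q = Suc r" using assms(1) by (simp add: r_def)
  have card_X: "card X = Suc (CARD('d option) * r)"
    using assms(3) by (simp add: r_def)
  have fin_X: "finite X" using card_X by (metis card.infinite nat.distinct(1))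
  have "X \<noteq> {}" using card_X by auto
  \<comment> \<open>Homogenisation: \<open>None\<close> is the extra coordinate on which every point
    is 0.\<close>
  define w where "w y i = (case i of None \<Rightarrow> 0 | Some j \<Rightarrow> y $ j)" for y :: "ereal ^ 'd" and i
  have w_fin: "w y i \<noteq> \<infinity>" if "y \<in> X" for y i
    using that assms(2) by (auto simp: w_def Rmax_vec_def Rmax_def split: option.split)
  have w_None: "w y None = 0" for y by (simp add: w_def)
  obtain N l x where x_None: "x None = 0"
    and le: "\<And>y i. y \<in> X \<Longrightarrow> l y + w y i \<le> x i"
    and NX: "\<And>i. N i \<subseteq> X" and eq: "\<And>i y. y \<in> N i \<Longrightarrow> l y + w y i = x i"
    and card_N: "\<And>I. card X * card I \<le> CARD('d option) * card (\<Union>i\<in>I. N i)"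
    by (rule exists_balanced_contact[of X w None])
      (assumption | rule fin_X \<open>X \<noteq> {}\<close> w_fin w_None | rule that)+
  have hall: "card I * r < card (\<Union>i\<in>I. N i)" if "I \<noteq> {}" for I
  proof -
    have "CARD('d option) * (card I * r) < card X * card I"
      using that card_X by (simp add: card_gt_0_iff algebra_simps)
    then have "CARD('d option) * (card I * r) < CARD('d option) * card (\<Union>i\<in>I. N i)"
      using card_N[of I] by linarith
    then show ?thesis by (rule mult_less_cancel1[THEN iffD1, THEN conjunct2])
  qed
  have "finite (N i)" for i using NX fin_X by (rule finite_subset)
  then obtain M where MN: "\<And>i. M i \<subseteq> N i" and card_M: "\<And>i. card (M i) = Suc r"
    and hall_M: "\<And>I. I \<noteq> {} \<Longrightarrow> card I * r < card (\<Union>i\<in>I. M i)"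
    using exists_uniform_subsystem[of N r] hall by blast
  have "(\<Union>i. M i) \<subseteq> X" using MN NX by blast
  \<comment> \<open>The inequality for all indices already forces \<open>card X\<close> vertices, so
    no point of \<open>X\<close> is left uncovered.\<close>
  moreover from this have "card (\<Union>i. M i) = card X"
    using hall_M[of UNIV] card_mono[OF fin_X, of "\<Union>i. M i"] card_X by simp
  ultimately have M_X: "(\<Union>i. M i) = X" by (intro card_subset_eq fin_X)
  define x' where "x' = (\<chi> j. x (Some j))"
  have l_le: "l y \<le> 0" if "y \<in> X" for y
    using le[OF that, of None] x_None by (simp add: w_def)
  have hull: "x' \<in> maxplus_hull Y" if Y: "Y \<subseteq> X" "\<And>i. Y \<inter> M i \<noteq> {}" for Y
  proof -
    have fin_Y: "finite Y" using Y(1) fin_X by (rule finite_subset)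
    have max: "Max ((\<lambda>y. l y + w y i) ` Y) = x i" for i
    proof (rule Max_eqI)
      obtain y where y: "y \<in> Y" "y \<in> M i" using Y(2)[of i] by blast
      have "y \<in> N i" using y(2) MN by blast
      then have "x i = l y + w y i" by (rule eq[symmetric])
      then show "x i \<in> (\<lambda>y. l y + w y i) ` Y" using y(1) by (rule image_eqI)
    qed (use fin_Y Y(1) le in auto)
    have "x (Some j) \<noteq> \<infinity>" for j
    proof -
      obtain y where y: "y \<in> X" "y \<in> N (Some j)" using Y MN by blast
      then show ?thesis using eq[OF y(2)] l_le[OF y(1)] w_fin[OF y(1), of "Some j"] by auto
    qed
    then have "x' \<in> Rmax_vec" by (simp add: x'_def Rmax_vec_def Rmax_def)
    moreover have "\<forall>y\<in>Y. l y \<in> Rmax" using l_le Y(1) by (force simp: Rmax_def)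
    moreover have "Max (l ` Y) = 0" using max[of None] x_None by (simp add: w_def)
    moreover have "x' = (\<chi> j. Max ((\<lambda>y. l y + y $ j) ` Y))"
      using max[of "Some _"] by (simp add: w_def x'_def)
    moreover have "Y \<noteq> {}" using Y(2) by blast
    ultimately show ?thesis unfolding maxplus_hull_def by blast
  qed
  have "fact (q - 1) ^ CARD('d) = fact r ^ (CARD('d option) - 1)"
    by (simp add: r_def)
  also have "\<dots> \<le> card {P. partition_on X P \<and> card P = q \<and> (\<forall>Y\<in>P. \<forall>i. Y \<inter> M i \<noteq> {})}"
    using card_transversal_partitions[of M r] card_M hall_M card_X by (simp add: M_X q)
  also have "\<dots> \<le> card {P. maxplus_tverberg_partition q X P}"
  proof (rule card_mono)
    show "finite {P. maxplus_tverberg_partition q X P}"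
      by (rule finite_subset[of _ "Pow (Pow X)"])
        (auto simp: maxplus_tverberg_partition_def partition_on_def fin_X)
    show "{P. partition_on X P \<and> card P = q \<and> (\<forall>Y\<in>P. \<forall>i. Y \<inter> M i \<noteq> {})}
        \<subseteq> {P. maxplus_tverberg_partition q X P}"
    proof clarify
      fix P assume P: "partition_on X P" "q = card P" "\<forall>Y\<in>P. \<forall>i. Y \<inter> M i \<noteq> {}"
      then have "\<forall>Y\<in>P. x' \<in> maxplus_hull Y"
        using partition_onD1[OF P(1)] by (auto intro!: hull)
      then show "maxplus_tverberg_partition (card P) X P"
        using P unfolding maxplus_tverberg_partition_def by blast
    qed
  qed
  finally show ?thesis .
qed

end
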